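(* Let $x_1,\dots,x_n$ and $y_1,\dots,y_n$ be points of $\mathcal{X}\subset\mathbb{R}^d$ and $\lambda_n>0$, and let $$f^*:=\min_{w\in\mathcal{H}}\ \frac1n\sum_{i=1}^n\langle w,\Phi(x_i)\rangle-\frac1n\sum_{j=1}^n\log\langle w,\Phi(y_j)\rangle+\frac{\lambda_n}{2}\|w\|_{\mathcal{H}}^2 .$$ Then $f^*$ has the equivalent dual form $$f^*=-\min_{\alpha>0}\Big\{-1-\frac1n\sum_{j=1}^n\log(n\alpha_j)+\frac{1}{2\lambda_n}\sum_{i,j}\alpha_i\alpha_jK(y_i,y_j)+\frac{1}{2\lambda_nn^2}\sum_{i,j}K(x_i,x_j)-\frac{1}{\lambda_nn}\sum_{i,j}\alpha_jK(x_i,y_j)\Big\},$$ where the minimum is over $\alpha\in\mathbb{R}^n$ with all $\alpha_j>0$ and all sums over $i,j$ run over $1\le i,j\le n$. Moreover, the optimal dual solution $\widehat\alpha$ is linked to the optimal primal solution $\widehat w$ via $$\widehat w=\frac{1}{\lambda_n}\Big(\sum_{j=1}^n\widehat\alpha_j\Phi(y_j)-\frac1n\sum_{i=1}^n\Phi(x_i)\Big).$$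
   Context: $K(x,y)=\exp\{-\|x-y\|^2/\sigma\}$ with $\sigma>0$ is the Gaussian kernel on $\mathcal{X}\subset\mathbb{R}^d$ ($\|\cdot\|$ Euclidean), $\mathcal{H}$ is the associated reproducing kernel Hilbert space with inner product $\langle\cdot,\cdot\rangle$ and norm $\|\cdot\|_{\mathcal{H}}$, and $\Phi:\mathcal{X}\to\mathcal{H}$ is the feature map, so that $K(x,x')=\langle\Phi(x),\Phi(x')\rangle$; any function $g$ in the space is written $g(x)=\langle w,\Phi(x)\rangle$ with $\|g\|_{\mathcal H}=\|w\|_{\mathcal{H}}$. The function $\log$ is extended to take the value $-\infty$ for non-positive arguments. (In the application, the $x_i$ are i.i.d. samples from a distribution $\mathbb{Q}$ and the $y_j$ are i.i.d. samples from a distribution $\mathbb{P}$.) *)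

theory Defs
  imports "HOL-Analysis.Analysis"
begin

definition gaussian_kernel :: "real \<Rightarrow> real ^ 'd \<Rightarrow> real ^ 'd \<Rightarrow> real" where
  "gaussian_kernel \<sigma> x y = exp (- ((norm (x - y))\<^sup>2 / \<sigma>))"

(* The Hilbert space 'h is, via ev (with ev g x read as g(x)), a space of real functions on X:
   pointwise operations, and elements agreeing on X are equal. Phi x is the kernel section
   K(-,x), and point evaluation at x is the inner product with it. Values of ev, Phi and K
   outside X are unconstrained. *)
definition is_rkhs ::
  "'a set \<Rightarrow> ('a \<Rightarrow> 'a \<Rightarrow> real) \<Rightarrow> ('h::{real_inner,complete_space} \<Rightarrow> 'a \<Rightarrow> real) \<Rightarrow> ('a \<Rightarrow> 'h) \<Rightarrow> bool"
where
  "is_rkhs X K ev \<Phi> \<longleftrightarrow>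
     (\<forall>x\<in>X. linear (\<lambda>g. ev g x)) \<and>
     inj (\<lambda>g. restrict (ev g) X) \<and>
     (\<forall>x\<in>X. \<forall>z\<in>X. ev (\<Phi> x) z = K z x) \<and>
     (\<forall>g. \<forall>x\<in>X. ev g x = g \<bullet> \<Phi> x)"

definition elog :: "real \<Rightarrow> ereal" where
  "elog t = (if 0 < t then ereal (ln t) else - \<infinity>)"

(* In this and the next definition, n = CARD('n), and the points and dual variables are
   indexed by the finite type 'n. In the primal objective the sum of elog terms is never
   \<infinity>, so the objective never meets an undefined \<infinity> - \<infinity>: it is
   \<infinity> iff some w \<bullet> \<Phi> (y j) is non-positive. *)
definition primal_objective ::
  "('a \<Rightarrow> 'h::real_inner) \<Rightarrow> ('n::finite \<Rightarrow> 'a) \<Rightarrow> ('n \<Rightarrow> 'a) \<Rightarrow> real \<Rightarrow> 'h \<Rightarrow> ereal"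
where
  "primal_objective \<Phi> x y lam w =
     ereal (1 / real CARD('n) * (\<Sum>i\<in>UNIV. w \<bullet> \<Phi> (x i)))
     - ereal (1 / real CARD('n)) * (\<Sum>j\<in>UNIV. elog (w \<bullet> \<Phi> (y j)))
     + ereal (lam / 2 * (norm w)\<^sup>2)"

definition dual_objective ::
  "('a \<Rightarrow> 'a \<Rightarrow> real) \<Rightarrow> ('n::finite \<Rightarrow> 'a) \<Rightarrow> ('n \<Rightarrow> 'a) \<Rightarrow> real \<Rightarrow> real ^ 'n \<Rightarrow> real"
where
  "dual_objective K x y lam \<alpha> =
     - 1
     - 1 / real CARD('n) * (\<Sum>j\<in>UNIV. ln (real CARD('n) * \<alpha> $ j))
     + 1 / (2 * lam) * (\<Sum>i\<in>UNIV. \<Sum>j\<in>UNIV. \<alpha> $ i * \<alpha> $ j * K (y i) (y j))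
     + 1 / (2 * lam * (real CARD('n))\<^sup>2) * (\<Sum>i\<in>UNIV. \<Sum>j\<in>UNIV. K (x i) (x j))
     - 1 / (lam * real CARD('n)) * (\<Sum>i\<in>UNIV. \<Sum>j\<in>UNIV. \<alpha> $ j * K (x i) (y j))"

(* m is the minimum, attained, of f over the points satisfying P. *)
definition is_min_value :: "('b \<Rightarrow> 'c::linorder) \<Rightarrow> ('b \<Rightarrow> bool) \<Rightarrow> 'c \<Rightarrow> bool" where
  "is_min_value f P m \<longleftrightarrow> (\<exists>z. is_arg_min f P z \<and> f z = m)"

end

theory Submission
  imports Defs "HOL-Real_Asymp.Real_Asymp"
begin

text \<open>
  Write \<open>v\<^sub>j = \<Phi> (y\<^sub>j)\<close>, \<open>u\<close> for the mean of the \<open>\<Phi> (x\<^sub>i)\<close>, and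
  \<open>w\<^sub>\<alpha> = (\<Sum> \<alpha>\<^sub>j v\<^sub>j - u) / \<lambda>\<close>. Completing the square shows that the sum of the primal
  objective at \<open>w\<close> and the dual objective at \<open>\<alpha>\<close> is exactly
  \<open>\<lambda>/2 \<parallel>w - w\<^sub>\<alpha>\<parallel>\<^sup>2 + 1/n \<Sum> (s\<^sub>j - 1 - ln s\<^sub>j)\<close> with \<open>s\<^sub>j = n \<alpha>\<^sub>j \<langle>w, v\<^sub>j\<rangle>\<close>,
  which is nonnegative. A dual minimizer exists because the Gaussian kernel is nonnegative with
  unit diagonal, so the quadratic term dominates \<open>\<parallel>\<alpha>\<parallel>\<^sup>2\<close>. Stationarity there says
  \<open>s\<^sub>j = 1\<close> for \<open>w = w\<^sub>\<alpha>\<close>, so the gap vanishes. The first summand of the gap makes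
  the primal minimizer unique and the second one the dual minimizer, even when the \<open>v\<^sub>j\<close> are
  linearly dependent.
\<close>

section \<open>Objectives in terms of feature vectors\<close>

definition residual :: "('n::finite \<Rightarrow> 'h::real_inner) \<Rightarrow> 'h \<Rightarrow> real ^ 'n \<Rightarrow> 'h" where
  "residual v u \<alpha> = (\<Sum>j\<in>UNIV. \<alpha> $ j *\<^sub>R v j) - u"

text \<open>The dual objective with kernel values read as inner products: its three kernel sums are
  the expansion of a single squared norm.\<close>

definition quad_dual :: "('n::finite \<Rightarrow> 'h::real_inner) \<Rightarrow> 'h \<Rightarrow> real \<Rightarrow> real ^ 'n \<Rightarrow> real" where
  "quad_dual v u lam \<alpha> =
     - 1 - 1 / real CARD('n) * (\<Sum>j\<in>UNIV. ln (real CARD('n) * \<alpha> $ j))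
     + (norm (residual v u \<alpha>))\<^sup>2 / (2 * lam)"

text \<open>Real-valued form of the primal objective, meaningful only where every
  \<open>w \<bullet> v j\<close> is positive.\<close>

definition real_primal :: "('n::finite \<Rightarrow> 'h::real_inner) \<Rightarrow> 'h \<Rightarrow> real \<Rightarrow> 'h \<Rightarrow> real" where
  "real_primal v u lam w =
     w \<bullet> u - 1 / real CARD('n) * (\<Sum>j\<in>UNIV. ln (w \<bullet> v j)) + lam / 2 * (norm w)\<^sup>2"

lemma primal_objective_pos:
  fixes x y :: "'n::finite \<Rightarrow> 'a"
  assumes "\<And>j. w \<bullet> \<Phi> (y j) > 0"
  shows "primal_objective \<Phi> x y lam w =
    ereal (real_primal (\<lambda>j. \<Phi> (y j)) ((1 / real CARD('n)) *\<^sub>R (\<Sum>i\<in>UNIV. \<Phi> (x i))) lam w)"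
  using assms by (simp add: primal_objective_def real_primal_def elog_def inner_sum_right)

lemma primal_objective_nonpos:
  fixes x y :: "'n::finite \<Rightarrow> 'a"
  assumes "w \<bullet> \<Phi> (y k) \<le> 0"
  shows "primal_objective \<Phi> x y lam w = \<infinity>"
proof -
  \<comment> \<open>In \<open>ereal\<close>, \<infinity> plus -\<infinity> is \<infinity>, so the
    single -\<infinity> absorbs the sum only once \<infinity> is excluded from the other
    terms.\<close>
  have "elog t \<noteq> \<infinity>" for t by (simp add: elog_def)
  then have "(\<Sum>j\<in>UNIV - {k}. elog (w \<bullet> \<Phi> (y j))) \<noteq> \<infinity>"
    by (simp add: sum_Pinfty)
  moreover have "elog (w \<bullet> \<Phi> (y k)) = - \<infinity>"
    using assms by (simp add: elog_def)
  ultimately have "(\<Sum>j\<in>UNIV. elog (w \<bullet> \<Phi> (y j))) = - \<infinity>"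
    by (simp add: sum.remove[of UNIV k])
  then show ?thesis by (simp add: primal_objective_def)
qed

lemma dual_objective_eq_quad_dual:
  fixes x y :: "'n::finite \<Rightarrow> 'a"
  assumes yy: "\<And>i j. K (y i) (y j) = \<Phi> (y i) \<bullet> \<Phi> (y j)"
    and xx: "\<And>i j. K (x i) (x j) = \<Phi> (x i) \<bullet> \<Phi> (x j)"
    and xy: "\<And>i j. K (x i) (y j) = \<Phi> (x i) \<bullet> \<Phi> (y j)"
  shows "dual_objective K x y lam =
    quad_dual (\<lambda>j. \<Phi> (y j)) ((1 / real CARD('n)) *\<^sub>R (\<Sum>i\<in>UNIV. \<Phi> (x i))) lam"
proof
  fix \<alpha> :: "real ^ 'n"
  define s where "s = (\<Sum>j\<in>UNIV. \<alpha> $ j *\<^sub>R \<Phi> (y j))"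
  define t where "t = (\<Sum>i\<in>UNIV. \<Phi> (x i))"
  define n where "n = real CARD('n)"
  have n: "n > 0" by (simp add: n_def)
  have ss: "(\<Sum>i\<in>UNIV. \<Sum>j\<in>UNIV. \<alpha> $ i * \<alpha> $ j * K (y i) (y j)) = s \<bullet> s"
    unfolding s_def yy inner_sum_left
    by (simp add: inner_sum_right sum_distrib_left mult_ac)
  have tt: "(\<Sum>i\<in>UNIV. \<Sum>j\<in>UNIV. K (x i) (x j)) = t \<bullet> t"
    unfolding t_def xx inner_sum_left by (simp add: inner_sum_right)
  have ts: "(\<Sum>i\<in>UNIV. \<Sum>j\<in>UNIV. \<alpha> $ j * K (x i) (y j)) = t \<bullet> s"
    unfolding s_def t_def xy inner_sum_left by (simp add: inner_sum_right)
  have "(norm (s - (1 / n) *\<^sub>R t))\<^sup>2 = s \<bullet> s + 1 / n\<^sup>2 * (t \<bullet> t) - 2 / n * (t \<bullet> s)"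
    unfolding power2_norm_eq_inner
    by (simp add: inner_diff_left inner_diff_right inner_commute power2_eq_square)
  then have "(norm (s - (1 / n) *\<^sub>R t))\<^sup>2 / (2 * lam)
      = 1 / (2 * lam) * (s \<bullet> s) + 1 / (2 * lam * n\<^sup>2) * (t \<bullet> t) - 1 / (lam * n) * (t \<bullet> s)"
    using n by (simp add: add_divide_distrib diff_divide_distrib mult_ac)
  then show "dual_objective K x y lam \<alpha> =
      quad_dual (\<lambda>j. \<Phi> (y j)) ((1 / real CARD('n)) *\<^sub>R (\<Sum>i\<in>UNIV. \<Phi> (x i))) lam \<alpha>"
    unfolding dual_objective_def quad_dual_def residual_def ss tt ts
      s_def[symmetric] t_def[symmetric] n_def[symmetric]
    by simp
qed

section \<open>The duality gap\<close>

text \<open>Positivity lets the logarithms of the two objectives merge. The cross term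
  \<open>- (w \<bullet> r)\<close> of the square, with \<open>r\<close> the residual, cancels
  against the linear part of the slack sum, which equals
  \<open>w \<bullet> r + w \<bullet> u\<close>.\<close>

lemma duality_gap:
  fixes v :: "'n::finite \<Rightarrow> 'h::real_inner"
  assumes "lam > 0" and w: "\<And>j. w \<bullet> v j > 0" and \<alpha>: "\<And>j. \<alpha> $ j > 0"
  shows "real_primal v u lam w + quad_dual v u lam \<alpha> =
    lam / 2 * (norm (w - (1 / lam) *\<^sub>R residual v u \<alpha>))\<^sup>2
    + 1 / real CARD('n) * (\<Sum>j\<in>UNIV. real CARD('n) * \<alpha> $ j * (w \<bullet> v j) - 1
        - ln (real CARD('n) * \<alpha> $ j * (w \<bullet> v j)))"
proof -
  define n where "n = real CARD('n)"
  have n: "n > 0" by (simp add: n_def)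
  define r where "r = residual v u \<alpha>"
  have ln: "ln (n * \<alpha> $ j * (w \<bullet> v j)) = ln (n * \<alpha> $ j) + ln (w \<bullet> v j)" for j
    using w[of j] \<alpha>[of j] n by (simp add: ln_mult)
  have wr: "(\<Sum>j\<in>UNIV. \<alpha> $ j * (w \<bullet> v j)) = w \<bullet> r + w \<bullet> u"
    by (simp add: r_def residual_def inner_diff_right inner_sum_right)
  have sum: "(\<Sum>j\<in>UNIV. n * \<alpha> $ j * (w \<bullet> v j) - 1 - ln (n * \<alpha> $ j * (w \<bullet> v j)))
    = n * (w \<bullet> r + w \<bullet> u) - n - (\<Sum>j\<in>UNIV. ln (n * \<alpha> $ j)) - (\<Sum>j\<in>UNIV. ln (w \<bullet> v j))"
    unfolding ln wr[symmetric]
    by (simp add: sum_subtractf sum.distrib sum_distrib_left mult.assoc n_def)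
  have sq: "(norm (w - (1 / lam) *\<^sub>R r))\<^sup>2 = (norm w)\<^sup>2 - 2 / lam * (w \<bullet> r) + (norm r)\<^sup>2 / lam\<^sup>2"
    unfolding power2_norm_eq_inner
    by (simp add: inner_diff_left inner_diff_right inner_commute power2_eq_square)
  show ?thesis
    unfolding real_primal_def quad_dual_def n_def[symmetric] r_def[symmetric] sum sq
    using n \<open>lam > 0\<close> by (simp add: field_simps power2_eq_square)
qed

lemma ln_slack_nonneg:
  fixes t :: real
  assumes "t > 0"
  shows "0 \<le> t - 1 - ln t"
  using ln_le_minus_one[OF assms] by simp

section \<open>Stationarity of dual minimizers\<close>

text \<open>The feasible set is open, so the partial derivative in coordinate \<open>k\<close>,
  namely \<open>- 1 / (n * a) + (r \<bullet> v k) / lam\<close>, vanishes at a minimizer.\<close>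

lemma quad_dual_minimizer_stationary:
  fixes v :: "'n::finite \<Rightarrow> 'h::real_inner"
  assumes "lam > 0"
    and min: "is_arg_min (quad_dual v u lam) (\<lambda>\<alpha>. \<forall>j. \<alpha> $ j > 0) \<alpha>"
  shows "real CARD('n) * \<alpha> $ k * ((1 / lam) *\<^sub>R residual v u \<alpha> \<bullet> v k) = 1"
proof -
  define n where "n = real CARD('n)"
  have n: "n > 0" by (simp add: n_def)
  define r where "r = residual v u \<alpha>"
  define a where "a = \<alpha> $ k"
  have pos: "\<And>j. \<alpha> $ j > 0" using min by (simp add: is_arg_min_def)
  then have a: "a > 0" by (simp add: a_def)
  define C where "C = - 1 - 1 / n * (\<Sum>j\<in>UNIV - {k}. ln (n * \<alpha> $ j))"
  \<comment> \<open>The dual objective along the \<open>k\<close>-th axis through \<alpha>;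
    \<open>C\<close> collects what does not depend on \<open>t\<close>.\<close>
  define g where "g t = C - 1 / n * ln (n * (a + t))
     + ((norm r)\<^sup>2 + 2 * t * (r \<bullet> v k) + t\<^sup>2 * (norm (v k))\<^sup>2) / (2 * lam)" for t
  have g: "quad_dual v u lam (\<alpha> + t *\<^sub>R axis k 1) = g t" for t
  proof -
    have c: "(\<alpha> + t *\<^sub>R axis k 1) $ j = (if j = k then a + t else \<alpha> $ j)" for j
      by (simp add: axis_def a_def)
    have res: "residual v u (\<alpha> + t *\<^sub>R axis k 1) = r + t *\<^sub>R v k"
      unfolding residual_def r_def c
      by (simp add: sum.remove[of UNIV k] a_def scaleR_left_distrib)
    have sq: "(norm (r + t *\<^sub>R v k))\<^sup>2 = (norm r)\<^sup>2 + 2 * t * (r \<bullet> v k) + t\<^sup>2 * (norm (v k))\<^sup>2"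
      unfolding power2_norm_eq_inner
      by (simp add: inner_add_left inner_add_right inner_commute power2_eq_square algebra_simps)
    have "(\<Sum>j\<in>UNIV. ln (n * (\<alpha> + t *\<^sub>R axis k 1) $ j))
        = ln (n * (a + t)) + (\<Sum>j\<in>UNIV - {k}. ln (n * \<alpha> $ j))"
      unfolding c by (simp add: sum.remove[of UNIV k])
    then show ?thesis
      unfolding quad_dual_def n_def[symmetric] res sq g_def C_def by (simp add: algebra_simps)
  qed
  have "(g has_real_derivative (- 1 / n * (n / (n * a)) + 2 * (r \<bullet> v k) / (2 * lam))) (at 0)"
    unfolding g_def using n a \<open>lam > 0\<close>
    by (auto intro!: derivative_eq_intros simp: field_simps)
  \<comment> \<open>Radius \<open>a\<close> keeps coordinate \<open>k\<close> positive, so the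
    shifted point stays feasible.\<close>
  moreover have "\<forall>t. \<bar>0 - t\<bar> < a \<longrightarrow> g 0 \<le> g t"
  proof safe
    fix t assume "\<bar>0 - t\<bar> < a"
    then have "\<forall>j. (\<alpha> + t *\<^sub>R axis k 1) $ j > 0"
      using pos by (auto simp: axis_def a_def)
    then have "quad_dual v u lam \<alpha> \<le> g t"
      using min unfolding g[symmetric] is_arg_min_def by (meson not_le)
    then show "g 0 \<le> g t" using g[of 0] by simp
  qed
  ultimately have "- 1 / n * (n / (n * a)) + 2 * (r \<bullet> v k) / (2 * lam) = 0"
    by (rule DERIV_local_min[OF _ a])
  then show ?thesis
    unfolding n_def[symmetric] r_def[symmetric] a_def[symmetric]
    using n a \<open>lam > 0\<close> by (simp add: field_simps)
qed

section \<open>Existence of a dual minimizer\<close>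

text \<open>The function tends to infinity at both ends: the logarithm dominates near 0, the square
  for large \<open>t\<close>.\<close>

lemma square_minus_ln_sublevel_bounded:
  fixes c n B :: real
  assumes "c > 0" "n > 0"
  obtains \<epsilon> M where "\<epsilon> > 0" "\<And>t. t > 0 \<Longrightarrow> c * t\<^sup>2 - 1 / n * ln (n * t) \<le> B \<Longrightarrow> \<epsilon> \<le> t \<and> t \<le> M"
proof -
  have "filterlim (\<lambda>t. c * t\<^sup>2 - 1 / n * ln (n * t)) at_top at_top"
    using assms by real_asymp
  then obtain M where M: "\<And>t. t \<ge> M \<Longrightarrow> c * t\<^sup>2 - 1 / n * ln (n * t) > B"
    unfolding filterlim_at_top_dense eventually_at_top_linorder by blast
  have "filterlim (\<lambda>t. c * t\<^sup>2 - 1 / n * ln (n * t)) at_top (at_right 0)"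
    using assms by real_asymp
  then obtain \<epsilon> where \<epsilon>: "\<epsilon> > 0" "\<And>t. 0 < t \<Longrightarrow> t < \<epsilon> \<Longrightarrow> c * t\<^sup>2 - 1 / n * ln (n * t) > B"
    unfolding filterlim_at_top_dense eventually_at_right_field by blast
  show ?thesis
    by (rule that[of \<epsilon> M]) (use M \<epsilon> in \<open>force simp: not_le[symmetric]\<close>)+
qed

text \<open>Dropping the nonnegative off-diagonal Gram terms leaves a sum of one-variable functions,
  so that each coordinate can be confined separately.\<close>

lemma quad_dual_ge_separable:
  fixes v :: "'n::finite \<Rightarrow> 'h::real_inner"
  assumes "lam > 0" and unit: "\<And>j. norm (v j) = 1" and nonneg: "\<And>i j. v i \<bullet> v j \<ge> 0"
    and pos: "\<And>j. \<alpha> $ j > 0"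
  shows "quad_dual v u lam \<alpha> \<ge> - 1 - (norm u)\<^sup>2 / (2 * lam)
    + (\<Sum>j\<in>UNIV. 1 / (4 * lam) * (\<alpha> $ j)\<^sup>2 - 1 / real CARD('n) * ln (real CARD('n) * \<alpha> $ j))"
proof -
  define s where "s = (\<Sum>j\<in>UNIV. \<alpha> $ j *\<^sub>R v j)"
  have "(\<Sum>j\<in>UNIV. (\<alpha> $ j)\<^sup>2) \<le> (\<Sum>i\<in>UNIV. \<Sum>j\<in>UNIV. \<alpha> $ i * (\<alpha> $ j * (v i \<bullet> v j)))"
  proof (rule sum_mono)
    fix i
    have "(\<alpha> $ i)\<^sup>2 = \<alpha> $ i * (\<alpha> $ i * (v i \<bullet> v i))"
      by (simp add: power2_norm_eq_inner[symmetric] unit power2_eq_square)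
    also have "\<dots> \<le> (\<Sum>j\<in>UNIV. \<alpha> $ i * (\<alpha> $ j * (v i \<bullet> v j)))"
      by (rule member_le_sum) (simp_all add: pos[THEN less_imp_le] nonneg)
    finally show "(\<alpha> $ i)\<^sup>2 \<le> (\<Sum>j\<in>UNIV. \<alpha> $ i * (\<alpha> $ j * (v i \<bullet> v j)))" .
  qed
  also have "\<dots> = (norm s)\<^sup>2"
    unfolding power2_norm_eq_inner s_def inner_sum_left
    by (simp add: inner_sum_right sum_distrib_left mult_ac)
  also have "\<dots> \<le> 2 * (norm (s - u))\<^sup>2 + 2 * (norm u)\<^sup>2"
  proof -
    \<comment> \<open>Parallelogram law for \<open>s - u\<close> and \<open>u\<close>; its factor 2
      turns \<open>1 / (2 * lam)\<close> into \<open>1 / (4 * lam)\<close>.\<close>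
    have "(norm s)\<^sup>2 + (norm (s - 2 *\<^sub>R u))\<^sup>2 = 2 * (norm (s - u))\<^sup>2 + 2 * (norm u)\<^sup>2"
      unfolding power2_norm_eq_inner by (simp add: algebra_simps inner_commute)
    then show ?thesis by (metis le_add_same_cancel1 zero_le_power2)
  qed
  finally have "(\<Sum>j\<in>UNIV. (\<alpha> $ j)\<^sup>2) / (4 * lam) \<le> (norm (s - u))\<^sup>2 / (2 * lam) + (norm u)\<^sup>2 / (2 * lam)"
    using \<open>lam > 0\<close> by (simp add: field_simps)
  then show ?thesis
    unfolding quad_dual_def residual_def s_def[symmetric]
    by (simp add: sum_subtractf sum_distrib_left sum_divide_distrib)
qed

lemma quad_dual_minimizer_exists:
  fixes v :: "'n::finite \<Rightarrow> 'h::real_inner"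
  assumes "lam > 0" and unit: "\<And>j. norm (v j) = 1" and nonneg: "\<And>i j. v i \<bullet> v j \<ge> 0"
  shows "\<exists>\<alpha>. is_arg_min (quad_dual v u lam) (\<lambda>\<alpha>. \<forall>j. \<alpha> $ j > 0) \<alpha>"
proof -
  define n where "n = real CARD('n)"
  have n: "n > 0" by (simp add: n_def)
  define h where "h t = 1 / (4 * lam) * t\<^sup>2 - 1 / n * ln (n * t)" for t
  \<comment> \<open>After \<open>ln\<close> is bounded linearly, what remains is a parabola with
    minimum \<open>- lam\<close> at \<open>t = 2 * lam\<close>.\<close>
  have h_ge: "h t \<ge> - lam" if "t > 0" for t
  proof -
    have "1 / n * ln (n * t) \<le> t"
      using ln_le_minus_one[of "n * t"] n that by (simp add: field_simps)
    moreover have "1 / (4 * lam) * t\<^sup>2 - t + lam = 1 / (4 * lam) * (t - 2 * lam)\<^sup>2"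
      using \<open>lam > 0\<close> by (simp add: field_simps power2_eq_square)
    moreover have "1 / (4 * lam) * (t - 2 * lam)\<^sup>2 \<ge> 0" using \<open>lam > 0\<close> by simp
    ultimately show ?thesis unfolding h_def by linarith
  qed
  define one :: "real ^ 'n" where "one = 1"
  define T where "T = quad_dual v u lam one"
  \<comment> \<open>If the dual value is at most \<open>T\<close>, the separable bound limits the
    sum of all \<open>h (\<alpha> $ j)\<close>. The other coordinates contribute at least
    \<open>- (n * lam)\<close>, so each single one is at most \<open>B\<close>.\<close>
  define B where "B = T + 1 + (norm u)\<^sup>2 / (2 * lam) + n * lam"
  obtain \<epsilon> M where "\<epsilon> > 0" and box: "\<And>t. t > 0 \<Longrightarrow> h t \<le> B \<Longrightarrow> \<epsilon> \<le> t \<and> t \<le> M"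
    using square_minus_ln_sublevel_bounded[of "1 / (4 * lam)" n B] n \<open>lam > 0\<close>
    unfolding h_def by (metis divide_pos_pos mult_pos_pos zero_less_numeral zero_less_one)
  \<comment> \<open>A compact box inside the open orthant, since \<epsilon> is positive; it contains
    the sublevel set at \<open>T\<close>, so a minimizer over it is global.\<close>
  define S :: "(real ^ 'n) set" where "S = cbox (\<chi> j. \<epsilon>) (\<chi> j. M)"
  have in_S: "\<alpha> \<in> S" if pos: "\<And>j. \<alpha> $ j > 0" and le: "quad_dual v u lam \<alpha> \<le> T" for \<alpha>
  proof -
    have "h (\<alpha> $ k) \<le> B" for k
    proof -
      have "- (n * lam) \<le> (\<Sum>j\<in>UNIV - {k}. - lam)"
        using \<open>lam > 0\<close> by (simp add: n_def card_Diff_singleton)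
      also have "\<dots> \<le> (\<Sum>j\<in>UNIV - {k}. h (\<alpha> $ j))"
        by (rule sum_mono) (simp add: h_ge pos)
      finally have "h (\<alpha> $ k) - n * lam \<le> (\<Sum>j\<in>UNIV. h (\<alpha> $ j))"
        by (simp add: sum.remove[of UNIV k])
      also have "\<dots> \<le> T + 1 + (norm u)\<^sup>2 / (2 * lam)"
        using quad_dual_ge_separable[where v = v and u = u, OF \<open>lam > 0\<close> unit nonneg pos] le
        unfolding h_def n_def by simp
      finally show ?thesis by (simp add: B_def)
    qed
    then show ?thesis using box pos by (simp add: S_def mem_box_cart)
  qed
  have S_pos: "\<alpha> $ j > 0" if "\<alpha> \<in> S" for \<alpha> j
    using that \<open>\<epsilon> > 0\<close> by (force simp: S_def mem_box_cart intro: less_le_trans)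
  have one: "one \<in> S" by (rule in_S) (simp_all add: T_def one_def)
  have "continuous_on S (quad_dual v u lam)"
    unfolding quad_dual_def residual_def using S_pos n \<open>lam > 0\<close>
    by (auto intro!: continuous_intros simp: less_imp_neq[symmetric])
  then obtain \<alpha> where \<alpha>: "\<alpha> \<in> S" "\<And>\<beta>. \<beta> \<in> S \<Longrightarrow> quad_dual v u lam \<alpha> \<le> quad_dual v u lam \<beta>"
    using continuous_attains_inf[of S "quad_dual v u lam"] one
    by (metis S_def compact_cbox empty_iff)
  have "\<not> quad_dual v u lam \<beta> < quad_dual v u lam \<alpha>" if "\<And>j. \<beta> $ j > 0" for \<beta>
  proof
    assume *: "quad_dual v u lam \<beta> < quad_dual v u lam \<alpha>"
    also have "\<dots> \<le> T" unfolding T_def using \<alpha>(2)[OF one] .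
    finally have "\<beta> \<in> S" using in_S that by simp
    then show False using \<alpha>(2)[of \<beta>] * by simp
  qed
  then show ?thesis using \<alpha>(1) S_pos unfolding is_arg_min_def by blast
qed

section \<open>Strong duality, uniqueness and the primal-dual link\<close>

theorem lemma5:
  fixes X :: "(real ^ 'd) set"
    and \<sigma> lam :: real
    and ev :: "'h::{real_inner,complete_space} \<Rightarrow> real ^ 'd \<Rightarrow> real"
    and \<Phi> :: "real ^ 'd \<Rightarrow> 'h"
    and x y :: "'n::finite \<Rightarrow> real ^ 'd"
  assumes "\<sigma> > 0"
    and "is_rkhs X (gaussian_kernel \<sigma>) ev \<Phi>"
    and "\<And>i. x i \<in> X" and "\<And>j. y j \<in> X"
    and "lam > 0"
  shows
    "(\<exists>fstar::real.
        is_min_value (primal_objective \<Phi> x y lam) (\<lambda>_. True) (ereal fstar) \<and>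
        is_min_value (dual_objective (gaussian_kernel \<sigma>) x y lam) (\<lambda>\<alpha>. \<forall>j. \<alpha> $ j > 0) (- fstar)) \<and>
     (\<exists>!w. is_arg_min (primal_objective \<Phi> x y lam) (\<lambda>_. True) w) \<and>
     (\<exists>!\<alpha>. is_arg_min (dual_objective (gaussian_kernel \<sigma>) x y lam) (\<lambda>\<alpha>. \<forall>j. \<alpha> $ j > 0) \<alpha>) \<and>
     (\<forall>w \<alpha>.
        is_arg_min (primal_objective \<Phi> x y lam) (\<lambda>_. True) w \<longrightarrow>
        is_arg_min (dual_objective (gaussian_kernel \<sigma>) x y lam) (\<lambda>\<alpha>. \<forall>j. \<alpha> $ j > 0) \<alpha> \<longrightarrow>
        w = (1 / lam) *\<^sub>R
              ((\<Sum>j\<in>UNIV. \<alpha> $ j *\<^sub>R \<Phi> (y j))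
               - (1 / real CARD('n)) *\<^sub>R (\<Sum>i\<in>UNIV. \<Phi> (x i))))"
proof -
  define v where "v = (\<lambda>j. \<Phi> (y j))"
  define u where "u = (1 / real CARD('n)) *\<^sub>R (\<Sum>i\<in>UNIV. \<Phi> (x i))"
  define n where "n = real CARD('n)"
  have n: "n > 0" by (simp add: n_def)
  let ?P = "primal_objective \<Phi> x y lam"
  let ?D = "quad_dual v u lam"
  let ?pos = "\<lambda>\<alpha>::real ^ 'n. \<forall>j. \<alpha> $ j > 0"
  \<comment> \<open>The reproducing property applied to the kernel section at \<open>b\<close>,
    evaluated at \<open>a\<close>.\<close>
  have K: "gaussian_kernel \<sigma> a b = \<Phi> a \<bullet> \<Phi> b" if "a \<in> X" "b \<in> X" for a b
    using assms(2) that unfolding is_rkhs_def by (metis inner_commute)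
  have dual_eq: "dual_objective (gaussian_kernel \<sigma>) x y lam = ?D"
    unfolding v_def u_def
    by (rule dual_objective_eq_quad_dual) (simp_all add: K assms(3,4))
  have vv: "v i \<bullet> v j = gaussian_kernel \<sigma> (y i) (y j)" for i j
    by (simp add: v_def K assms(4))
  have unit: "norm (v j) = 1" for j
    using vv[of j j] by (simp add: gaussian_kernel_def norm_eq_1)
  obtain \<alpha> where \<alpha>: "is_arg_min ?D ?pos \<alpha>"
    using quad_dual_minimizer_exists[of lam v u] assms(5) unit
    by (auto simp: vv gaussian_kernel_def)
  have \<alpha>_pos: "\<And>j. \<alpha> $ j > 0" using \<alpha> by (simp add: is_arg_min_def)
  define w where "w = (1 / lam) *\<^sub>R residual v u \<alpha>"
  have stat: "n * \<alpha> $ j * (w \<bullet> v j) = 1" for j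
    unfolding n_def w_def by (rule quad_dual_minimizer_stationary[OF assms(5) \<alpha>])
  have w_pos: "w \<bullet> v j > 0" for j
    using stat[of j] \<alpha>_pos[of j] n by (metis mult_pos_pos zero_less_mult_pos zero_less_one)
  have P_pos: "?P z = ereal (real_primal v u lam z)" if "\<And>j. z \<bullet> v j > 0" for z
    using that unfolding v_def u_def by (rule primal_objective_pos)
  have "real_primal v u lam w + ?D \<alpha> = 0"
    unfolding duality_gap[where v = v, OF assms(5) w_pos \<alpha>_pos] w_def[symmetric] n_def[symmetric]
    by (simp add: stat)
  then have Pw: "?P w = ereal (- ?D \<alpha>)" by (simp add: P_pos w_pos)
  \<comment> \<open>Weak duality against the fixed \<alpha>, keeping the squared distance from the
    gap: this term later forces uniqueness of \<open>w\<close>.\<close>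
  have P_ge: "ereal (- ?D \<alpha> + lam / 2 * (norm (z - w))\<^sup>2) \<le> ?P z" for z
  proof (cases "\<forall>j. z \<bullet> v j > 0")
    case True
    have "0 \<le> 1 / n * (\<Sum>j\<in>UNIV. n * \<alpha> $ j * (z \<bullet> v j) - 1 - ln (n * \<alpha> $ j * (z \<bullet> v j)))"
      using True \<alpha>_pos n by (intro mult_nonneg_nonneg sum_nonneg ln_slack_nonneg) simp_all
    then have "lam / 2 * (norm (z - w))\<^sup>2 \<le> real_primal v u lam z + ?D \<alpha>"
      using duality_gap[OF assms(5), of z v \<alpha> u] True \<alpha>_pos unfolding n_def w_def by simp
    then show ?thesis using True by (simp add: P_pos)
  next
    case False
    then obtain k where "z \<bullet> \<Phi> (y k) \<le> 0" by (auto simp: v_def not_less)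
    from primal_objective_nonpos[of z \<Phi> y, OF this] show ?thesis by simp
  qed
  have w_min: "is_arg_min ?P (\<lambda>_. True) w"
  proof -
    have "?P w \<le> ?P z" for z
    proof -
      have "?P w \<le> ereal (- ?D \<alpha> + lam / 2 * (norm (z - w))\<^sup>2)"
        using assms(5) by (simp add: Pw)
      also note P_ge
      finally show ?thesis .
    qed
    then show ?thesis by (simp add: is_arg_min_def not_less)
  qed
  have w_unique: "z = w" if "is_arg_min ?P (\<lambda>_. True) z" for z
  proof -
    have "?P z \<le> ?P w" using that by (simp add: is_arg_min_def not_less)
    then have "ereal (- ?D \<alpha> + lam / 2 * (norm (z - w))\<^sup>2) \<le> ereal (- ?D \<alpha>)"
      using P_ge[of z] Pw by (metis order_trans)
    then have "lam / 2 * (norm (z - w))\<^sup>2 \<le> 0" by simp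
    then have "(norm (z - w))\<^sup>2 \<le> 0" using assms(5) by (simp add: mult_le_0_iff)
    then show ?thesis by simp
  qed
  \<comment> \<open>The gap between \<open>w\<close> and a second minimizer \<beta> is at most 0
    with both summands nonnegative, so every slack vanishes. Equality in
    \<open>ln t \<le> t - 1\<close> holds only at 1, which fixes each coordinate as
    \<open>1 / (n * (w \<bullet> v j))\<close>.\<close>
  have \<alpha>_unique: "\<beta> = \<alpha>" if \<beta>: "is_arg_min ?D ?pos \<beta>" for \<beta>
  proof -
    have \<beta>_pos: "\<And>j. \<beta> $ j > 0" using \<beta> by (simp add: is_arg_min_def)
    define s where "s j = n * \<beta> $ j * (w \<bullet> v j)" for j
    have s_pos: "s j > 0" for j using n \<beta>_pos w_pos by (simp add: s_def)
    have "?D \<beta> \<le> ?D \<alpha>" using \<alpha>_pos \<beta> unfolding is_arg_min_def by (meson not_less)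
    then have "real_primal v u lam w + ?D \<beta> \<le> 0"
      using \<open>real_primal v u lam w + ?D \<alpha> = 0\<close> by simp
    moreover have "lam / 2 * (norm (w - (1 / lam) *\<^sub>R residual v u \<beta>))\<^sup>2 \<ge> 0"
      using assms(5) by simp
    ultimately have "1 / n * (\<Sum>j\<in>UNIV. s j - 1 - ln (s j)) \<le> 0"
      using duality_gap[where v = v and u = u, OF assms(5) w_pos \<beta>_pos] unfolding n_def s_def by linarith
    then have "(\<Sum>j\<in>UNIV. s j - 1 - ln (s j)) \<le> 0"
      using n by (simp add: divide_le_0_iff)
    then have "(\<Sum>j\<in>UNIV. s j - 1 - ln (s j)) = 0"
      by (intro antisym sum_nonneg ln_slack_nonneg s_pos)
    then have "s j - 1 - ln (s j) = 0" for j
      by (subst (asm) sum_nonneg_eq_0_iff) (simp_all add: ln_le_minus_one s_pos)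
    then have "s j = 1" for j
      using ln_eq_minus_one[OF s_pos[of j]] by simp
    then have "n * (w \<bullet> v j) * \<beta> $ j = n * (w \<bullet> v j) * \<alpha> $ j" for j
      using stat[of j] by (simp add: s_def mult.commute mult.left_commute)
    then show ?thesis using n w_pos by (simp add: vec_eq_iff less_imp_neq[symmetric])
  qed
  have link: "w = (1 / lam) *\<^sub>R ((\<Sum>j\<in>UNIV. \<alpha> $ j *\<^sub>R \<Phi> (y j))
      - (1 / real CARD('n)) *\<^sub>R (\<Sum>i\<in>UNIV. \<Phi> (x i)))"
    by (simp add: w_def residual_def v_def u_def)
  have "is_min_value ?P (\<lambda>_. True) (ereal (- ?D \<alpha>))"
    unfolding is_min_value_def using w_min Pw by blast
  \<comment> \<open>The double negation matches \<open>- fstar\<close> for the witness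
    \<open>fstar = - ?D \<alpha>\<close>.\<close>
  moreover have "is_min_value ?D ?pos (- (- ?D \<alpha>))"
    unfolding is_min_value_def using \<alpha> by auto
  ultimately show ?thesis
    unfolding dual_eq using w_min w_unique \<alpha> \<alpha>_unique link by blast
qed

end
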